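(* Let $(\alpha_n)_{n\ge 1}$ be a sequence in $(0,1)$ with $\lim_{n\to\infty} n\alpha_n=\alpha$ for some $\alpha\in(0,1)$, and let $c_n\in\mathbb{R}$ be defined by $\Phi(-c_n)=\alpha_n$. For $\rho\in[0,1]$ let $$\mathrm{FWER}_n(\rho)=P\big(X_i> c_n \text{ for some } i\in\{1,\dots,n\}\big),$$ where $(X_1,\dots,X_n)$ is jointly normal with $X_i\sim N(0,1)$ for all $i$ and $\mathrm{Corr}(X_i,X_j)=\rho$ for all $i\ne j$. Then for every $\rho\in[0,1]$ there is $N$ such that for all $n\ge N$ $$\mathrm{FWER}_n(\rho)\ \le\ \alpha_n+(1-\rho)\big[1-\alpha_n-(1-\alpha_n)^n\big].$$
   Context: $\Phi$ is the cumulative distribution function of $N(0,1)$. Setting: the null hypotheses are $H_{0i}:X_i\sim N(0,1)$, $i=1,\dots,n$; each $H_{0i}$ is tested at size $\alpha_n$ and is rejected when $X_i>c_n$. $\mathrm{FWER}_n(\rho)$ is the probability of at least one false rejection, computed under the intersection of all null hypotheses. *)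

theory Defs
  imports "HOL-Probability.Probability"
begin

definition Phi :: "real \<Rightarrow> real" where
  "Phi = cdf std_normal_distribution"

(* Normal random variable, the degenerate case N(mu, 0) included. *)
definition normal_rv :: "'a measure \<Rightarrow> ('a \<Rightarrow> real) \<Rightarrow> bool" where
  "normal_rv M Y \<longleftrightarrow> Y \<in> borel_measurable M \<and>
     ((\<exists>\<mu> \<sigma>. \<sigma> > 0 \<and> distributed M lborel Y (normal_density \<mu> \<sigma>)) \<or>
      (\<exists>\<mu>. AE \<omega> in M. Y \<omega> = \<mu>))"

(* Joint normality: every linear combination is normal. Singular covariance
   matrices are allowed, as needed for correlation 1. *)
definition jointly_normal :: "'a measure \<Rightarrow> 'i set \<Rightarrow> ('i \<Rightarrow> 'a \<Rightarrow> real) \<Rightarrow> bool" where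
  "jointly_normal M I X \<longleftrightarrow> (\<forall>t. normal_rv M (\<lambda>\<omega>. \<Sum>i\<in>I. t i * X i \<omega>))"

definition covariance :: "'a measure \<Rightarrow> ('a \<Rightarrow> real) \<Rightarrow> ('a \<Rightarrow> real) \<Rightarrow> real" where
  "covariance M Y Z =
     (\<integral>\<omega>. (Y \<omega> - (\<integral>\<omega>'. Y \<omega>' \<partial>M)) * (Z \<omega> - (\<integral>\<omega>'. Z \<omega>' \<partial>M)) \<partial>M)"

definition correlation :: "'a measure \<Rightarrow> ('a \<Rightarrow> real) \<Rightarrow> ('a \<Rightarrow> real) \<Rightarrow> real" where
  "correlation M Y Z =
     covariance M Y Z / (sqrt (covariance M Y Y) * sqrt (covariance M Z Z))"

definition equicorrelated_std_normal ::
    "'a measure \<Rightarrow> nat \<Rightarrow> real \<Rightarrow> (nat \<Rightarrow> 'a \<Rightarrow> real) \<Rightarrow> bool" where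
  "equicorrelated_std_normal M n \<rho> X \<longleftrightarrow>
     prob_space M \<and>
     jointly_normal M {1..n} X \<and>
     (\<forall>i\<in>{1..n}. distributed M lborel (X i) std_normal_density) \<and>
     (\<forall>i\<in>{1..n}. \<forall>j\<in>{1..n}. i \<noteq> j \<longrightarrow> correlation M (X i) (X j) = \<rho>)"

(* Probability of at least one rejection among X 1, ..., X n at threshold c. Every
   rejection is a false one when all null hypotheses X i ~ N(0,1) hold under M. *)
definition FWER :: "'a measure \<Rightarrow> nat \<Rightarrow> (nat \<Rightarrow> 'a \<Rightarrow> real) \<Rightarrow> real \<Rightarrow> real" where
  "FWER M n X c = measure M {\<omega> \<in> space M. \<exists>i\<in>{1..n}. X i \<omega> > c}"

end

theory Submission
  imports Defs
begin

text \<open>The claimed bound interpolates linearly in \<open>\<rho>\<close> between the error rates at the two ends: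
\<open>1 - (1 - \<alpha>s n) ^ n\<close> for independent observations (\<open>\<rho> = 0\<close>) and \<open>\<alpha>s n\<close> for identical
ones (\<open>\<rho> = 1\<close>). There it holds for every \<open>n \<ge> 1\<close>.

Strictly between the ends the two sides separate in the limit. The right-hand side tends
to \<open>(1 - \<rho>) * (1 - exp (- \<alpha>)) > 0\<close>, whereas the error rate tends to \<open>0\<close>. The reason is
that \<open>c n\<close> is calibrated to observations of variance \<open>1\<close>, of which \<open>\<rho>\<close> belongs to a
factor common to all of them. This factor stays bounded in probability while \<open>c n\<close> grows,
so a rejection essentially needs one of \<open>n\<close> variables of variance \<open>1 - \<rho>\<close> to exceed
\<open>c n\<close>; relative to their standard deviation, this is a threshold \<open>\<kappa> * c n\<close> with
\<open>\<kappa> > 1\<close>. By \<open>Phi_scaled_le\<close> the tail there is of smaller order than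
\<open>Phi (- c n) = \<alpha>s n\<close>, which is of order \<open>1 / n\<close>, so a union bound over the \<open>n\<close> variables
suffices. The average of the observations serves as the common factor
(\<open>FWER_le_common_plus_idiosyncratic\<close>). The resulting bound depends only on \<open>n\<close> and \<open>\<rho>\<close>,
which makes the threshold \<open>N\<close> uniform over all probability spaces.

The case \<open>\<rho> = 0\<close> requires that uncorrelated jointly normal variables are independent.
Joint normality is a statement about linear combinations, hence determines the joint
characteristic function, and independence follows from its factorization
(\<open>prob_product_if_joint_char_factors\<close>).\<close>

section \<open>Factorizing characteristic functions\<close>

text \<open>After division by its mean, a nonnegative weight \<open>W\<close> is a change of measure. The
hypothesis says that \<open>X\<close> has the same characteristic function under the new measure
as under the old one, so by Levy's uniqueness theorem it has the same law.\<close>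
lemma (in prob_space) expectation_indicator_if_characters_factor_nonneg:
  fixes W X :: "'a \<Rightarrow> real"
  assumes [measurable]: "W \<in> borel_measurable M" "X \<in> borel_measurable M" "A \<in> sets borel"
    and W: "\<And>\<omega>. \<omega> \<in> space M \<Longrightarrow> 0 \<le> W \<omega> \<and> W \<omega> \<le> B"
    and eq: "\<And>s. (\<integral>\<omega>. of_real (W \<omega>) * iexp (s * X \<omega>) \<partial>M)
                  = of_real (\<integral>\<omega>. W \<omega> \<partial>M) * (\<integral>\<omega>. iexp (s * X \<omega>) \<partial>M)"
  shows "(\<integral>\<omega>. W \<omega> * indicator A (X \<omega>) \<partial>M) = (\<integral>\<omega>. W \<omega> \<partial>M) * (\<integral>\<omega>. indicator A (X \<omega>) \<partial>M)"
proof -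
  define w where "w = (\<integral>\<omega>. W \<omega> \<partial>M)"
  have intW: "integrable M W"
    by (rule integrable_const_bound[where B=B]) (use W in \<open>auto intro!: AE_I2\<close>)
  have w0: "w \<ge> 0" unfolding w_def by (rule integral_nonneg_AE) (use W in \<open>auto intro!: AE_I2\<close>)
  show ?thesis
  proof (cases "w = 0")
    case True
    then have AE0: "AE \<omega> in M. W \<omega> = 0"
      using integral_nonneg_eq_0_iff_AE[OF intW] W unfolding w_def by (auto intro!: AE_I2)
    have "(\<integral>\<omega>. W \<omega> * indicator A (X \<omega>) \<partial>M) = (\<integral>\<omega>. 0 \<partial>M)"
      by (rule integral_cong_AE) (use AE0 in auto)
    then show ?thesis using True by (simp add: w_def)
  next
    case False
    then have w: "w > 0" using w0 by simp
    define Q where "Q = density M (\<lambda>\<omega>. ennreal (W \<omega> / w))"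
    have nn: "AE \<omega> in M. 0 \<le> W \<omega> / w" using W w by (auto intro!: AE_I2)
    have "emeasure Q (space Q) = (\<integral>\<^sup>+\<omega>. ennreal (W \<omega> / w) \<partial>M)"
      unfolding Q_def by (subst emeasure_density) (auto intro!: nn_integral_cong simp: indicator_def)
    also have "\<dots> = ennreal (\<integral>\<omega>. W \<omega> / w \<partial>M)"
      by (rule nn_integral_eq_integral) (use intW nn in auto)
    also have "\<dots> = 1" using w by (simp add: w_def)
    finally have "prob_space Q" by (rule prob_spaceI)
    then interpret Q: prob_space Q .
    have spQ [simp]: "space Q = space M" "sets Q = sets M" unfolding Q_def by auto
    have [measurable]: "X \<in> borel_measurable Q" unfolding Q_def by simp
    have "distr Q borel X = distr M borel X"
    proof (rule Levy_uniqueness)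
      show "real_distribution (distr Q borel X)" by (rule Q.real_distribution_distr) simp
      show "real_distribution (distr M borel X)" by (rule real_distribution_distr) simp
      show "char (distr Q borel X) = char (distr M borel X)"
      proof
        fix s
        have "char (distr Q borel X) s = (\<integral>\<omega>. iexp (s * X \<omega>) \<partial>Q)"
          unfolding char_def by (subst integral_distr) auto
        also have "\<dots> = (\<integral>\<omega>. (W \<omega> / w) *\<^sub>R iexp (s * X \<omega>) \<partial>M)"
          unfolding Q_def by (rule integral_density) (use nn in auto)
        also have "\<dots> = (\<integral>\<omega>. (1 / of_real w) * (of_real (W \<omega>) * iexp (s * X \<omega>)) \<partial>M)"
          by (rule Bochner_Integration.integral_cong) (auto simp: scaleR_conv_of_real)
        also have "\<dots> = (1 / of_real w) * (\<integral>\<omega>. of_real (W \<omega>) * iexp (s * X \<omega>) \<partial>M)"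
          by (rule integral_mult_right_zero)
        also have "\<dots> = (\<integral>\<omega>. iexp (s * X \<omega>) \<partial>M)"
          using w unfolding eq by (simp flip: w_def)
        also have "\<dots> = char (distr M borel X) s"
          unfolding char_def by (subst integral_distr) auto
        finally show "char (distr Q borel X) s = char (distr M borel X) s" .
      qed
    qed
    then have "(\<integral>x. indicator A x \<partial>distr Q borel X) = (\<integral>x. indicator A x \<partial>distr M borel X :: real)"
      by simp
    then have *: "(\<integral>\<omega>. indicator A (X \<omega>) \<partial>Q) = (\<integral>\<omega>. indicator A (X \<omega>) \<partial>M :: real)"
      by (subst (asm) (1 2) integral_distr) auto
    have "(\<integral>\<omega>. indicator A (X \<omega>) \<partial>Q :: real) = (\<integral>\<omega>. (W \<omega> / w) *\<^sub>R indicator A (X \<omega>) \<partial>M)"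
      unfolding Q_def by (rule integral_density) (use nn in auto)
    also have "\<dots> = (\<integral>\<omega>. W \<omega> * indicator A (X \<omega>) \<partial>M) / w"
      by simp
    finally show ?thesis using * w by (simp add: w_def field_simps)
  qed
qed

text \<open>The hypothesis on \<open>V\<close> is linear in \<open>V\<close>, is satisfied by constants, and passes to the
complex conjugate (conjugate it at \<open>- s\<close>). It therefore passes to \<open>Re V + B\<close>, which is
a nonnegative weight.\<close>
lemma (in prob_space) expectation_indicator_if_characters_factor_Re:
  fixes V :: "'a \<Rightarrow> complex" and X :: "'a \<Rightarrow> real"
  assumes [measurable]: "V \<in> borel_measurable M" "X \<in> borel_measurable M" "A \<in> sets borel"
    and V: "\<And>\<omega>. \<omega> \<in> space M \<Longrightarrow> norm (V \<omega>) \<le> B"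
    and eq: "\<And>s. (\<integral>\<omega>. V \<omega> * iexp (s * X \<omega>) \<partial>M) = (\<integral>\<omega>. V \<omega> \<partial>M) * (\<integral>\<omega>. iexp (s * X \<omega>) \<partial>M)"
  shows "(\<integral>\<omega>. Re (V \<omega>) * indicator A (X \<omega>) \<partial>M) = (\<integral>\<omega>. Re (V \<omega>) \<partial>M) * (\<integral>\<omega>. indicator A (X \<omega>) \<partial>M)"
proof -
  have intV: "integrable M V"
    by (rule integrable_const_bound[where B=B]) (use V in \<open>auto intro!: AE_I2\<close>)
  have intVe: "integrable M (\<lambda>\<omega>. V \<omega> * iexp (s * X \<omega>))" for s
    by (rule integrable_const_bound[where B=B]) (use V in \<open>auto intro!: AE_I2 simp: norm_mult\<close>)
  have [measurable]: "(\<lambda>\<omega>. cnj (V \<omega>)) \<in> borel_measurable M"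
    by (rule borel_measurable_continuous_on[OF _ assms(1)]) (intro continuous_intros)
  have intcVe: "integrable M (\<lambda>\<omega>. cnj (V \<omega>) * iexp (s * X \<omega>))" for s
    by (rule integrable_const_bound[where B=B]) (use V in \<open>auto intro!: AE_I2 simp: norm_mult\<close>)
  have inte: "integrable M (\<lambda>\<omega>. iexp (s * X \<omega>))" for s
    by (rule integrable_iexp) auto
  have intR: "integrable M (\<lambda>\<omega>. Re (V \<omega>))" using intV by simp
  have cnj_eq: "(\<integral>\<omega>. cnj (V \<omega>) * iexp (s * X \<omega>) \<partial>M)
      = cnj (\<integral>\<omega>. V \<omega> \<partial>M) * (\<integral>\<omega>. iexp (s * X \<omega>) \<partial>M)" for s
  proof -
    have c: "cnj (iexp (- s * X \<omega>)) = iexp (s * X \<omega>)" for \<omega> by (simp add: exp_cnj)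
    have "(\<integral>\<omega>. cnj (V \<omega>) * iexp (s * X \<omega>) \<partial>M) = (\<integral>\<omega>. cnj (V \<omega> * iexp (- s * X \<omega>)) \<partial>M)"
      by (simp only: complex_cnj_mult c)
    also have "\<dots> = cnj (\<integral>\<omega>. V \<omega> * iexp (- s * X \<omega>) \<partial>M)"
      by (rule Bochner_Integration.integral_cnj)
    also have "\<dots> = cnj (\<integral>\<omega>. V \<omega> \<partial>M) * (\<integral>\<omega>. cnj (iexp (- s * X \<omega>)) \<partial>M)"
      by (simp only: eq[of "-s"] complex_cnj_mult Bochner_Integration.integral_cnj)
    finally show ?thesis by (simp only: c)
  qed
  have "(\<integral>\<omega>. (Re (V \<omega>) + B) * indicator A (X \<omega>) \<partial>M)
      = (\<integral>\<omega>. Re (V \<omega>) + B \<partial>M) * (\<integral>\<omega>. indicator A (X \<omega>) \<partial>M)"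
  proof (rule expectation_indicator_if_characters_factor_nonneg[where B="2 * B"])
    show "0 \<le> Re (V \<omega>) + B \<and> Re (V \<omega>) + B \<le> 2 * B" if "\<omega> \<in> space M" for \<omega>
      using V[OF that] abs_Re_le_cmod[of "V \<omega>"] by linarith
    fix s
    have "(\<integral>\<omega>. of_real (Re (V \<omega>) + B) * iexp (s * X \<omega>) \<partial>M)
        = (\<integral>\<omega>. (1/2) * (V \<omega> * iexp (s * X \<omega>)) + (1/2) * (cnj (V \<omega>) * iexp (s * X \<omega>)) + of_real B * iexp (s * X \<omega>) \<partial>M)"
    proof (rule Bochner_Integration.integral_cong[OF refl])
      fix \<omega>
      have "complex_of_real (Re (V \<omega>)) = (1/2) * (V \<omega> + cnj (V \<omega>))" by (simp add: complex_eq_iff)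
      then show "of_real (Re (V \<omega>) + B) * iexp (s * X \<omega>)
          = (1/2) * (V \<omega> * iexp (s * X \<omega>)) + (1/2) * (cnj (V \<omega>) * iexp (s * X \<omega>)) + of_real B * iexp (s * X \<omega>)"
        by (simp add: algebra_simps add_divide_distrib)
    qed
    also have "\<dots> = (1/2) * (\<integral>\<omega>. V \<omega> * iexp (s * X \<omega>) \<partial>M) + (1/2) * (\<integral>\<omega>. cnj (V \<omega>) * iexp (s * X \<omega>) \<partial>M)
        + of_real B * (\<integral>\<omega>. iexp (s * X \<omega>) \<partial>M)"
      using intVe[of s] intcVe[of s] inte[of s] by simp
    also have "\<dots> = ((1/2) * ((\<integral>\<omega>. V \<omega> \<partial>M) + cnj (\<integral>\<omega>. V \<omega> \<partial>M)) + of_real B) * (\<integral>\<omega>. iexp (s * X \<omega>) \<partial>M)"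
      by (simp only: eq cnj_eq) (simp add: algebra_simps add_divide_distrib)
    also have "(1/2) * ((\<integral>\<omega>. V \<omega> \<partial>M) + cnj (\<integral>\<omega>. V \<omega> \<partial>M)) + of_real B
        = complex_of_real (\<integral>\<omega>. Re (V \<omega>) + B \<partial>M)"
      using intR intV by (simp add: prob_space complex_eq_iff integral_Re)
    finally show "(\<integral>\<omega>. of_real (Re (V \<omega>) + B) * iexp (s * X \<omega>) \<partial>M)
        = of_real (\<integral>\<omega>. Re (V \<omega>) + B \<partial>M) * (\<integral>\<omega>. iexp (s * X \<omega>) \<partial>M)" .
  qed auto
  moreover have i1: "integrable M (\<lambda>\<omega>. Re (V \<omega>) * indicator A (X \<omega>))"
    by (rule Bochner_Integration.integrable_bound[OF intR]) (auto intro!: AE_I2 simp: indicator_def)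
  moreover have i2: "integrable M (\<lambda>\<omega>. indicator A (X \<omega>) :: real)"
    by (rule integrable_const_bound[where B=1]) auto
  ultimately show ?thesis
    using intR by (simp add: algebra_simps prob_space)
qed

text \<open>A bounded random variable that is uncorrelated with every character of \<open>X\<close> is
uncorrelated with every event of \<open>X\<close>. Only the imaginary part remains to be treated; it
is the real part of \<open>- \<i> * V\<close>.\<close>
lemma (in prob_space) expectation_indicator_if_characters_factor:
  fixes V :: "'a \<Rightarrow> complex" and X :: "'a \<Rightarrow> real"
  assumes [measurable]: "V \<in> borel_measurable M" "X \<in> borel_measurable M" "A \<in> sets borel"
    and V: "\<And>\<omega>. \<omega> \<in> space M \<Longrightarrow> norm (V \<omega>) \<le> B"
    and eq: "\<And>s. (\<integral>\<omega>. V \<omega> * iexp (s * X \<omega>) \<partial>M) = (\<integral>\<omega>. V \<omega> \<partial>M) * (\<integral>\<omega>. iexp (s * X \<omega>) \<partial>M)"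
  shows "(\<integral>\<omega>. V \<omega> * of_real (indicator A (X \<omega>)) \<partial>M)
    = (\<integral>\<omega>. V \<omega> \<partial>M) * of_real (\<integral>\<omega>. indicator A (X \<omega>) \<partial>M)"
proof -
  have intV: "integrable M V"
    by (rule integrable_const_bound[where B=B]) (use V in \<open>auto intro!: AE_I2\<close>)
  have intVA: "integrable M (\<lambda>\<omega>. V \<omega> * of_real (indicator A (X \<omega>)))"
    by (rule Bochner_Integration.integrable_bound[OF intV]) (auto intro!: AE_I2 simp: indicator_def)
  have re: "(\<integral>\<omega>. Re (V \<omega>) * indicator A (X \<omega>) \<partial>M) = (\<integral>\<omega>. Re (V \<omega>) \<partial>M) * (\<integral>\<omega>. indicator A (X \<omega>) \<partial>M)"
    by (rule expectation_indicator_if_characters_factor_Re[where B=B]) (use V eq in auto)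
  have "(\<integral>\<omega>. Re (- \<i> * V \<omega>) * indicator A (X \<omega>) \<partial>M)
      = (\<integral>\<omega>. Re (- \<i> * V \<omega>) \<partial>M) * (\<integral>\<omega>. indicator A (X \<omega>) \<partial>M)"
  proof (rule expectation_indicator_if_characters_factor_Re[where B=B])
    fix s
    have "(\<integral>\<omega>. - \<i> * V \<omega> * iexp (s * X \<omega>) \<partial>M) = - \<i> * (\<integral>\<omega>. V \<omega> * iexp (s * X \<omega>) \<partial>M)"
      by (simp add: mult.assoc)
    then show "(\<integral>\<omega>. - \<i> * V \<omega> * iexp (s * X \<omega>) \<partial>M) = (\<integral>\<omega>. - \<i> * V \<omega> \<partial>M) * (\<integral>\<omega>. iexp (s * X \<omega>) \<partial>M)"
      unfolding eq by simp
  qed (use V in \<open>auto simp: norm_mult\<close>)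
  then have im: "(\<integral>\<omega>. Im (V \<omega>) * indicator A (X \<omega>) \<partial>M) = (\<integral>\<omega>. Im (V \<omega>) \<partial>M) * (\<integral>\<omega>. indicator A (X \<omega>) \<partial>M)"
    by simp
  show ?thesis
    using re im intV intVA by (simp add: complex_eq_iff flip: integral_Re integral_Im)
qed

text \<open>Kac's theorem: random variables whose joint characteristic function is the product of
the marginal ones are independent. Uniqueness in one dimension suffices when the
coordinates are converted one at a time: the characters of the coordinates in
\<open>J\<close> are replaced by indicators, while the other coordinates keep arbitrary frequencies.
Having the formula for all frequencies of the next coordinate \<open>k\<close> is exactly what allows
the replacement at \<open>k\<close>.\<close>
theorem (in prob_space) prob_product_if_joint_char_factors:
  fixes X :: "'i \<Rightarrow> 'a \<Rightarrow> real"
  assumes fin: "finite I"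
    and X[measurable]: "\<And>i. i \<in> I \<Longrightarrow> X i \<in> borel_measurable M"
    and A[measurable]: "\<And>i. i \<in> I \<Longrightarrow> A i \<in> sets borel"
    and char: "\<And>t. (\<integral>\<omega>. iexp (\<Sum>i\<in>I. t i * X i \<omega>) \<partial>M) = (\<Prod>i\<in>I. \<integral>\<omega>. iexp (t i * X i \<omega>) \<partial>M)"
  shows "prob {\<omega> \<in> space M. \<forall>i\<in>I. X i \<omega> \<in> A i} = (\<Prod>i\<in>I. prob {\<omega> \<in> space M. X i \<omega> \<in> A i})"
proof -
  define \<phi> where "\<phi> i s = (\<integral>\<omega>. iexp (s * X i \<omega>) \<partial>M)" for i s
  define p where "p i = (\<integral>\<omega>. indicator (A i) (X i \<omega>) \<partial>M :: real)" for i
  define D where "D J \<omega> = (\<Prod>j\<in>J. complex_of_real (indicator (A j) (X j \<omega>)))" for J \<omega>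
  have mixed: "(\<integral>\<omega>. D J \<omega> * iexp (\<Sum>i\<in>I-J. t i * X i \<omega>) \<partial>M)
      = (\<Prod>j\<in>J. of_real (p j)) * (\<Prod>i\<in>I-J. \<phi> i (t i))" if "J \<subseteq> I" for J t
  proof -
    have "finite J" using fin that finite_subset by blast
    then show ?thesis using that
    proof (induction J arbitrary: t rule: finite_induct)
      case empty
      then show ?case using char by (simp add: \<phi>_def D_def)
    next
      case (insert k J)
      define R where "R = I - insert k J"
      have k: "k \<in> I" "J \<subseteq> I" "k \<notin> J" using insert by auto
      have IJ: "I - J = insert k R" "k \<notin> R" "finite R" using k fin by (auto simp: R_def)
      have RI: "R \<subseteq> I" by (auto simp: R_def)
      define V where "V \<omega> = D J \<omega> * iexp (\<Sum>i\<in>R. t i * X i \<omega>)" for \<omega>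
      have [measurable]: "X k \<in> borel_measurable M" "A k \<in> sets borel" using k X A by auto
      have [measurable]: "D J \<in> borel_measurable M"
      proof -
        have "(\<lambda>\<omega>. complex_of_real (indicator (A j) (X j \<omega>))) \<in> borel_measurable M" if "j \<in> I" for j
        proof -
          have [measurable]: "X j \<in> borel_measurable M" "A j \<in> sets borel" using that X A by auto
          show ?thesis by measurable
        qed
        then show ?thesis
          unfolding D_def by (intro borel_measurable_prod) (use k in auto)
      qed
      have [measurable]: "(\<lambda>\<omega>. \<Sum>i\<in>R. t i * X i \<omega>) \<in> borel_measurable M"
        by (intro borel_measurable_sum borel_measurable_times X) (use RI in auto)
      have Vm[measurable]: "V \<in> borel_measurable M" unfolding V_def by measurable
      have D1: "norm (D J \<omega>) \<le> 1" for \<omega>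
        unfolding D_def by (subst prod_norm[symmetric], rule prod_le_1) (auto simp: indicator_def)
      have V1: "norm (V \<omega>) \<le> 1" for \<omega>
        unfolding V_def using D1 by (simp add: norm_mult)
      have Vs: "(\<integral>\<omega>. V \<omega> * iexp (s * X k \<omega>) \<partial>M)
          = (\<Prod>j\<in>J. of_real (p j)) * (\<phi> k s * (\<Prod>i\<in>R. \<phi> i (t i)))" for s
      proof -
        \<comment> \<open>The induction hypothesis is used with frequency s at coordinate k.\<close>
        have "(\<Sum>i\<in>I-J. (t(k:=s)) i * X i \<omega>) = (\<Sum>i\<in>R. t i * X i \<omega>) + s * X k \<omega>" for \<omega>
        proof -
          have "(\<Sum>i\<in>R. (t(k:=s)) i * X i \<omega>) = (\<Sum>i\<in>R. t i * X i \<omega>)"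
            by (rule sum.cong) (use IJ in auto)
          then show ?thesis using IJ by simp
        qed
        then have "V \<omega> * iexp (s * X k \<omega>) = D J \<omega> * iexp (\<Sum>i\<in>I-J. (t(k:=s)) i * X i \<omega>)" for \<omega>
          by (simp only: V_def of_real_add distrib_left exp_add mult.assoc)
        moreover have "(\<Prod>i\<in>R. \<phi> i ((t(k:=s)) i)) = (\<Prod>i\<in>R. \<phi> i (t i))"
          by (rule prod.cong) (use IJ in auto)
        ultimately show ?thesis
          using insert.IH[of "t(k:=s)"] k IJ by simp
      qed
      have V0: "(\<integral>\<omega>. V \<omega> \<partial>M) = (\<Prod>j\<in>J. of_real (p j)) * (\<Prod>i\<in>R. \<phi> i (t i))"
        using Vs[of 0] by (simp add: \<phi>_def prob_space)
      have "(\<integral>\<omega>. V \<omega> * of_real (indicator (A k) (X k \<omega>)) \<partial>M)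
          = (\<integral>\<omega>. V \<omega> \<partial>M) * of_real (\<integral>\<omega>. indicator (A k) (X k \<omega>) \<partial>M)"
        by (rule expectation_indicator_if_characters_factor[where B=1])
          (use V1 Vs V0 in \<open>auto simp: \<phi>_def\<close>)
      moreover have "D (insert k J) \<omega> * iexp (\<Sum>i\<in>R. t i * X i \<omega>) = V \<omega> * of_real (indicator (A k) (X k \<omega>))" for \<omega>
        using k insert.hyps by (simp add: V_def D_def)
      ultimately show ?case
        using V0 k insert.hyps by (simp add: p_def flip: R_def)
    qed
  qed
  have S: "{\<omega> \<in> space M. X i \<omega> \<in> A i} \<in> sets M" if "i \<in> I" for i
    using measurable_sets[OF X A] that by (simp add: vimage_def Int_def conj_commute)
  have p: "p i = prob {\<omega> \<in> space M. X i \<omega> \<in> A i}" if "i \<in> I" for i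
  proof -
    have "p i = (\<integral>\<omega>. indicator {\<omega> \<in> space M. X i \<omega> \<in> A i} \<omega> \<partial>M)"
      unfolding p_def by (rule Bochner_Integration.integral_cong) (auto simp: indicator_def)
    then show ?thesis using S[OF that] by simp
  qed
  have SI: "{\<omega> \<in> space M. \<forall>i\<in>I. X i \<omega> \<in> A i} \<in> sets M"
    by (rule sets.sets_Collect_finite_All[OF _ fin]) (rule S)
  have DI: "D I \<omega> = of_real (indicator {\<omega> \<in> space M. \<forall>i\<in>I. X i \<omega> \<in> A i} \<omega>)" if "\<omega> \<in> space M" for \<omega>
    using fin that unfolding D_def
    by (cases "\<forall>i\<in>I. X i \<omega> \<in> A i") (auto simp: indicator_def prod_zero_iff)
  have "complex_of_real (\<Prod>i\<in>I. p i) = (\<integral>\<omega>. D I \<omega> \<partial>M)"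
    using mixed[of I "\<lambda>_. 0"] by simp
  also have "\<dots> = (\<integral>\<omega>. of_real (indicator {\<omega> \<in> space M. \<forall>i\<in>I. X i \<omega> \<in> A i} \<omega>) \<partial>M)"
    by (rule Bochner_Integration.integral_cong) (use DI in auto)
  also have "\<dots> = of_real (prob {\<omega> \<in> space M. \<forall>i\<in>I. X i \<omega> \<in> A i})"
    using SI by (subst integral_complex_of_real) simp
  finally show ?thesis using p by (simp only: of_real_eq_iff) simp
qed

section \<open>Centered normal variables\<close>

lemma (in prob_space) centered_normal_rv_cases:
  assumes N: "normal_rv M Y" and EY: "(\<integral>\<omega>. Y \<omega> \<partial>M) = 0" and EY2: "(\<integral>\<omega>. (Y \<omega>)\<^sup>2 \<partial>M) = v"
  obtains "v > 0" "distributed M lborel Y (normal_density 0 (sqrt v))"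
  | "v = 0" "AE \<omega> in M. Y \<omega> = 0"
proof -
  have Ym[measurable]: "Y \<in> borel_measurable M" using N by (simp add: normal_rv_def)
  consider (1) \<mu> \<sigma> where "\<sigma> > 0" "distributed M lborel Y (normal_density \<mu> \<sigma>)"
    | (2) \<mu> where "AE \<omega> in M. Y \<omega> = \<mu>"
    using N unfolding normal_rv_def by blast
  then show thesis
  proof cases
    case 1
    then have "\<mu> = 0" using normal_distributed_expectation EY by metis
    moreover have "v = \<sigma>\<^sup>2" using normal_distributed_variance[OF 1] EY EY2 by simp
    ultimately show thesis using 1 that(1) by simp
  next
    case 2
    have "(\<integral>\<omega>. Y \<omega> \<partial>M) = (\<integral>\<omega>. \<mu> \<partial>M)" by (rule integral_cong_AE) (use 2 in auto)
    then have "\<mu> = 0" using EY by (simp add: prob_space)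
    moreover have "(\<integral>\<omega>. (Y \<omega>)\<^sup>2 \<partial>M) = (\<integral>\<omega>. \<mu>\<^sup>2 \<partial>M)" by (rule integral_cong_AE) (use 2 in auto)
    ultimately show thesis using 2 EY2 that(2) by simp
  qed
qed

lemma (in prob_space) char_centered_normal_rv:
  assumes N: "normal_rv M Y" and EY: "(\<integral>\<omega>. Y \<omega> \<partial>M) = 0" and EY2: "(\<integral>\<omega>. (Y \<omega>)\<^sup>2 \<partial>M) = v"
  shows "(\<integral>\<omega>. iexp (Y \<omega>) \<partial>M) = of_real (exp (- v / 2))"
proof -
  have Ym[measurable]: "Y \<in> borel_measurable M" using N by (simp add: normal_rv_def)
  from N EY EY2 show ?thesis
  proof (cases rule: centered_normal_rv_cases)
    case 1
    define Z where "Z \<omega> = (Y \<omega> - 0) / sqrt v" for \<omega>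
    have Z: "distributed M lborel Z std_normal_density"
      using normal_standard_normal_convert[of "sqrt v" Y 0] 1 unfolding Z_def by simp
    then have dZ: "distr M lborel Z = std_normal_distribution"
      by (simp add: distributed_def)
    have [measurable]: "Z \<in> borel_measurable M" unfolding Z_def by measurable
    have "(\<integral>\<omega>. iexp (Y \<omega>) \<partial>M) = (\<integral>\<omega>. iexp (sqrt v * Z \<omega>) \<partial>M)"
      using 1 by (simp add: Z_def)
    also have "\<dots> = (\<integral>z. iexp (sqrt v * z) \<partial>distr M lborel Z)"
      by (subst integral_distr) auto
    also have "\<dots> = char std_normal_distribution (sqrt v)"
      unfolding char_def dZ ..
    also have "\<dots> = of_real (exp (- v / 2))"
      using 1 by (simp add: char_std_normal_distribution)
    finally show ?thesis .
  next
    case 2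
    have "(\<integral>\<omega>. iexp (Y \<omega>) \<partial>M) = (\<integral>\<omega>. 1 \<partial>M)" by (rule integral_cong_AE) (use 2 in auto)
    then show ?thesis using 2 by (simp add: prob_space)
  qed
qed

interpretation std_normal: real_distribution std_normal_distribution
  by (rule real_dist_normal_dist)

lemma Phi_mono: "x \<le> y \<Longrightarrow> Phi x \<le> Phi y"
  unfolding Phi_def by (rule std_normal.cdf_nondecreasing)

lemma Phi_nonneg: "0 \<le> Phi x"
  unfolding Phi_def by (rule std_normal.cdf_nonneg)

lemma Phi_pos: "0 < Phi x"
proof -
  have "emeasure std_normal_distribution {..x} \<noteq> 0"
  proof
    assume "emeasure std_normal_distribution {..x} = 0"
    then have "AE y in lborel. ennreal (std_normal_density y) * indicator {..x} y = 0"
      by (subst (asm) emeasure_density) (auto simp: nn_integral_0_iff_AE)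
    then have "AE y in lborel. y \<notin> {..x}"
    proof eventually_elim
      case (elim y)
      have "std_normal_density y > 0" by (rule normal_density_pos) simp
      then show ?case using elim by (auto simp: indicator_def split: if_splits)
    qed
    then have "emeasure lborel {..x} = 0"
      by (subst (asm) AE_iff_measurable[OF _ refl]) (auto simp: atMost_def)
    then have "emeasure lborel {x-1..x} \<le> 0"
      using emeasure_mono[of "{x-1..x}" "{..x}" lborel] by auto
    then show False by simp
  qed
  then have "measure std_normal_distribution {..x} \<noteq> 0"
    by (simp add: std_normal.emeasure_eq_measure)
  then show ?thesis
    unfolding Phi_def cdf_def by (simp add: zero_less_measure_iff)
qed

lemma Phi_at_bot: "(Phi \<longlongrightarrow> 0) at_bot"
  unfolding Phi_def by (rule std_normal.cdf_lim_at_bot)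

lemma (in prob_space) std_normal_le:
  assumes "distributed M lborel Z std_normal_density"
  shows "prob {\<omega> \<in> space M. Z \<omega> \<le> x} = Phi x"
proof -
  have dZ: "distr M lborel Z = std_normal_distribution" and [measurable]: "Z \<in> borel_measurable M"
    using assms by (auto simp: distributed_def)
  have "Phi x = measure (distr M lborel Z) {..x}" by (simp add: Phi_def cdf_def dZ)
  also have "\<dots> = prob (Z -` {..x} \<inter> space M)" by (rule measure_distr) auto
  also have "Z -` {..x} \<inter> space M = {\<omega> \<in> space M. Z \<omega> \<le> x}" by auto
  finally show ?thesis by simp
qed

text \<open>The second moment is only bounded, so that one estimate serves the averages of the
observations, their deviations from the average, and the degenerate case.\<close>
lemma (in prob_space) centered_normal_tail_le:
  assumes N: "normal_rv M Y" and EY: "(\<integral>\<omega>. Y \<omega> \<partial>M) = 0" and EY2: "(\<integral>\<omega>. (Y \<omega>)\<^sup>2 \<partial>M) \<le> \<sigma>\<^sup>2"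
    and \<sigma>: "\<sigma> > 0" and d: "d \<ge> 0"
  shows "prob {\<omega> \<in> space M. Y \<omega> > d} \<le> Phi (- d / \<sigma>)"
proof -
  have Ym[measurable]: "Y \<in> borel_measurable M" using N by (simp add: normal_rv_def)
  define v where "v = (\<integral>\<omega>. (Y \<omega>)\<^sup>2 \<partial>M)"
  from N EY v_def[symmetric] show ?thesis
  proof (cases rule: centered_normal_rv_cases)
    case 1
    define s where "s = sqrt v"
    have s: "s > 0" "s \<le> \<sigma>" using 1 EY2 \<sigma> by (auto simp: s_def v_def real_le_lsqrt)
    have "distributed M lborel (\<lambda>\<omega>. 0 + (- 1 / s) * Y \<omega>) (normal_density (0 + (- 1 / s) * 0) (\<bar>- 1 / s\<bar> * s))"
      by (rule normal_density_affine) (use 1 s in \<open>auto simp: s_def\<close>)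
    then have Z: "distributed M lborel (\<lambda>\<omega>. (- 1 / s) * Y \<omega>) std_normal_density" using s by simp
    have "prob {\<omega> \<in> space M. Y \<omega> > d} \<le> prob {\<omega> \<in> space M. (- 1 / s) * Y \<omega> \<le> - d / s}"
      by (rule finite_measure_mono) (use s in \<open>auto simp: field_simps\<close>)
    also have "\<dots> = Phi (- d / s)" by (rule std_normal_le[OF Z])
    also have "\<dots> \<le> Phi (- d / \<sigma>)"
      by (rule Phi_mono) (use s d \<sigma> in \<open>simp add: divide_left_mono\<close>)
    finally show ?thesis .
  next
    case 2
    have "AE \<omega> in M. \<not> (Y \<omega> > d)" using 2(2) by eventually_elim (use d in auto)
    then have "prob {\<omega> \<in> space M. Y \<omega> > d} = 0" by (subst prob_eq_0) auto
    then show ?thesis using Phi_nonneg by simp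
  qed
qed

lemma (in prob_space) std_normal_tail_le:
  assumes D: "distributed M lborel Y std_normal_density"
  shows "prob {\<omega> \<in> space M. Y \<omega> > d} \<le> Phi (- d)"
proof -
  have [measurable]: "Y \<in> borel_measurable M" using D by (auto simp: distributed_def)
  have "distributed M lborel (\<lambda>\<omega>. 0 + (- 1) * Y \<omega>) (normal_density (0 + (- 1) * 0) (\<bar>- 1\<bar> * 1))"
    by (rule normal_density_affine) (use D in auto)
  then have Z: "distributed M lborel (\<lambda>\<omega>. - Y \<omega>) std_normal_density" by simp
  have "prob {\<omega> \<in> space M. Y \<omega> > d} \<le> prob {\<omega> \<in> space M. - Y \<omega> \<le> - d}"
    by (rule finite_measure_mono) auto
  then show ?thesis unfolding std_normal_le[OF Z] .
qed

text \<open>Stretching the threshold by a factor \<open>\<kappa> > 1\<close> makes a Gaussian tail smaller by an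
arbitrarily large factor. Indeed \<open>Phi (- (\<kappa> * x))\<close> is the mass that the density
\<open>\<kappa> * \<phi> (\<kappa> * y)\<close>, with \<open>\<phi>\<close> the standard normal density, puts on \<open>y \<le> - x\<close>, and there
its quotient by \<open>\<phi> y\<close> is \<open>\<kappa> * exp (- (\<kappa>\<^sup>2 - 1) * y\<^sup>2 / 2)\<close>, which is largest at \<open>y = - x\<close>.\<close>
lemma Phi_scaled_le:
  assumes k: "\<kappa> \<ge> 1" and x: "x \<ge> 0"
  shows "Phi (- (\<kappa> * x)) \<le> \<kappa> * exp (- ((\<kappa>\<^sup>2 - 1) * x\<^sup>2 / 2)) * Phi (- x)"
proof -
  define C where "C = \<kappa> * exp (- ((\<kappa>\<^sup>2 - 1) * x\<^sup>2 / 2))"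
  have C: "C \<ge> 0" using k by (simp add: C_def)
  \<comment> \<open>The identity is a standard normal variable, so dividing it by \<open>\<kappa>\<close> gives the stretched density.\<close>
  have D0: "distributed std_normal_distribution lborel (\<lambda>y. y) std_normal_density"
    by (auto simp: distributed_def intro!: distr_id2)
  have "distributed std_normal_distribution lborel (\<lambda>y. 0 + (1/\<kappa>) * y) (normal_density (0 + (1/\<kappa>) * 0) (\<bar>1/\<kappa>\<bar> * 1))"
    by (rule std_normal.normal_density_affine[OF D0]) (use k in auto)
  then have D: "distributed std_normal_distribution lborel (\<lambda>y. y / \<kappa>) (normal_density 0 (1/\<kappa>))"
    using k by simp
  have dens: "normal_density 0 (1/\<kappa>) y \<le> C * std_normal_density y" if "y \<le> - x" for y
  proof -
    have "x\<^sup>2 \<le> y\<^sup>2" using that x by (metis abs_le_square_iff abs_of_nonneg abs_of_nonpos minus_le_iff neg_le_0_iff_le order_trans le_minus_iff)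
    then have "(\<kappa>\<^sup>2 - 1) * x\<^sup>2 \<le> (\<kappa>\<^sup>2 - 1) * y\<^sup>2"
      using k by (intro mult_left_mono) (auto simp: one_le_power)
    then have e: "exp (- (\<kappa>\<^sup>2 * y\<^sup>2 / 2)) \<le> exp (- ((\<kappa>\<^sup>2 - 1) * x\<^sup>2 / 2)) * exp (- y\<^sup>2 / 2)"
      by (simp add: field_simps flip: exp_add)
    have "normal_density 0 (1/\<kappa>) y = \<kappa> / sqrt (2 * pi) * exp (- (\<kappa>\<^sup>2 * y\<^sup>2 / 2))"
      using k by (simp add: normal_density_def real_sqrt_divide real_sqrt_mult field_simps)
    also have "\<dots> \<le> \<kappa> / sqrt (2 * pi) * (exp (- ((\<kappa>\<^sup>2 - 1) * x\<^sup>2 / 2)) * exp (- y\<^sup>2 / 2))"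
      by (rule mult_left_mono[OF e]) (use k in auto)
    also have "\<dots> = C * std_normal_density y"
      by (simp add: C_def std_normal_density_def)
    finally show ?thesis .
  qed
  have "{..- (\<kappa> * x)} = (\<lambda>y. y / \<kappa>) -` {..-x} \<inter> space std_normal_distribution"
    using k by (auto simp: field_simps)
  then have "emeasure std_normal_distribution {..- (\<kappa> * x)}
      = (\<integral>\<^sup>+y. ennreal (normal_density 0 (1/\<kappa>) y) * indicator {..-x} y \<partial>lborel)"
    using distributed_emeasure[OF D, of "{..-x}"] by simp
  also have "\<dots> \<le> (\<integral>\<^sup>+y. ennreal C * (ennreal (std_normal_density y) * indicator {..-x} y) \<partial>lborel)"
    by (rule nn_integral_mono) (use dens C in \<open>auto simp: indicator_def simp flip: ennreal_mult\<close>)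
  also have "\<dots> = ennreal C * emeasure std_normal_distribution {..-x}"
    by (subst nn_integral_cmult) (auto simp: emeasure_density)
  finally have "ennreal (Phi (- (\<kappa> * x))) \<le> ennreal (C * Phi (- x))"
    by (simp add: Phi_def cdf_def std_normal.emeasure_eq_measure ennreal_mult C)
  then show ?thesis
    using C Phi_nonneg[of "-x"] by (simp add: C_def ennreal_le_iff)
qed

section \<open>Equicorrelated standard normal variables\<close>

lemma equicorrelation_quadratic_form:
  fixes t :: "'i \<Rightarrow> real"
  assumes "finite I"
  shows "(\<Sum>i\<in>I. \<Sum>j\<in>I. t i * t j * (if i = j then 1 else \<rho>))
    = (1 - \<rho>) * (\<Sum>i\<in>I. (t i)\<^sup>2) + \<rho> * (\<Sum>i\<in>I. t i)\<^sup>2"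
proof -
  have "(\<Sum>i\<in>I. \<Sum>j\<in>I. t i * t j * (if i = j then 1 else \<rho>))
      = (\<Sum>i\<in>I. \<Sum>j\<in>I. \<rho> * (t i * t j) + (if i = j then (1 - \<rho>) * (t i * t j) else 0))"
    by (intro sum.cong refl) (auto simp: algebra_simps)
  also have "\<dots> = \<rho> * (\<Sum>i\<in>I. \<Sum>j\<in>I. t i * t j) + (\<Sum>i\<in>I. (1 - \<rho>) * (t i * t i))"
    using assms by (simp add: sum.distrib sum_distrib_left)
  also have "\<dots> = (1 - \<rho>) * (\<Sum>i\<in>I. (t i)\<^sup>2) + \<rho> * (\<Sum>i\<in>I. t i)\<^sup>2"
    by (simp only: power2_eq_square sum_product flip: sum_distrib_left)
  finally show ?thesis .
qed

locale equicorrelated = prob_space M for M :: "'a measure" +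
  fixes n :: nat and \<rho> :: real and X :: "nat \<Rightarrow> 'a \<Rightarrow> real"
  assumes equicorrelated: "equicorrelated_std_normal M n \<rho> X"
begin

lemma normal_rv_sum: "normal_rv M (\<lambda>\<omega>. \<Sum>i\<in>{1..n}. t i * X i \<omega>)"
  using equicorrelated by (simp add: equicorrelated_std_normal_def jointly_normal_def)

lemma X_std_normal: "i \<in> {1..n} \<Longrightarrow> distributed M lborel (X i) std_normal_density"
  using equicorrelated by (simp add: equicorrelated_std_normal_def)

lemma measurable_X: "i \<in> {1..n} \<Longrightarrow> X i \<in> borel_measurable M"
  using X_std_normal[of i] by (auto simp: distributed_def)

lemma expectation_X: "i \<in> {1..n} \<Longrightarrow> (\<integral>\<omega>. X i \<omega> \<partial>M) = 0"
  by (rule standard_normal_distributed_expectation[OF X_std_normal])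

lemma expectation_X_square: "i \<in> {1..n} \<Longrightarrow> (\<integral>\<omega>. (X i \<omega>)\<^sup>2 \<partial>M) = 1"
  using standard_normal_distributed_variance[OF X_std_normal] expectation_X by simp

lemma integrable_X_power: "i \<in> {1..n} \<Longrightarrow> integrable M (\<lambda>\<omega>. (X i \<omega>)^k)"
  using distributed_integrable[OF X_std_normal, of i "\<lambda>x. x^k"] integrable_std_normal_moment[of k]
  by simp

lemma integrable_X: "i \<in> {1..n} \<Longrightarrow> integrable M (X i)"
  using integrable_X_power[of i 1] by simp

lemma integrable_X_product:
  assumes "i \<in> {1..n}" "j \<in> {1..n}"
  shows "integrable M (\<lambda>\<omega>. X i \<omega> * X j \<omega>)"
proof (rule Bochner_Integration.integrable_bound)
  show "integrable M (\<lambda>\<omega>. (X i \<omega>)\<^sup>2 + (X j \<omega>)\<^sup>2)"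
    using assms integrable_X_power by simp
  have "\<bar>a * b\<bar> \<le> \<bar>a\<^sup>2 + b\<^sup>2\<bar>" for a b :: real
  proof -
    have "2 * \<bar>a * b\<bar> \<le> a\<^sup>2 + b\<^sup>2"
      using sum_squares_bound[of "\<bar>a\<bar>" "\<bar>b\<bar>"] by (simp add: abs_mult)
    then show ?thesis using abs_ge_zero[of "a * b"] by linarith
  qed
  then show "AE \<omega> in M. norm (X i \<omega> * X j \<omega>) \<le> norm ((X i \<omega>)\<^sup>2 + (X j \<omega>)\<^sup>2)"
    by simp
qed (intro borel_measurable_times measurable_X assms)

lemma expectation_X_product:
  assumes "i \<in> {1..n}" "j \<in> {1..n}"
  shows "(\<integral>\<omega>. X i \<omega> * X j \<omega> \<partial>M) = (if i = j then 1 else \<rho>)"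
proof (cases "i = j")
  case True
  then show ?thesis using expectation_X_square assms by (simp add: power2_eq_square)
next
  case False
  then have "correlation M (X i) (X j) = \<rho>"
    using equicorrelated assms by (auto simp: equicorrelated_std_normal_def)
  then show ?thesis
    using False expectation_X_square assms
    by (simp add: correlation_def covariance_def expectation_X power2_eq_square)
qed

lemma expectation_sum: "(\<integral>\<omega>. (\<Sum>i\<in>{1..n}. t i * X i \<omega>) \<partial>M) = 0"
  using integrable_X expectation_X by (subst Bochner_Integration.integral_sum) auto

text \<open>The second moments of all linear combinations, hence by joint normality their laws. For
coefficients of sum zero only the factor \<open>1 - \<rho>\<close> survives: this gives the equality of
all observations for \<open>\<rho> = 1\<close> and the reduced variance of deviations from the average.\<close>
lemma expectation_sum_square:
  "(\<integral>\<omega>. (\<Sum>i\<in>{1..n}. t i * X i \<omega>)\<^sup>2 \<partial>M)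
    = (1 - \<rho>) * (\<Sum>i\<in>{1..n}. (t i)\<^sup>2) + \<rho> * (\<Sum>i\<in>{1..n}. t i)\<^sup>2"
proof -
  have "(\<integral>\<omega>. (\<Sum>i\<in>{1..n}. t i * X i \<omega>)\<^sup>2 \<partial>M)
      = (\<integral>\<omega>. (\<Sum>i\<in>{1..n}. \<Sum>j\<in>{1..n}. t i * t j * (X i \<omega> * X j \<omega>)) \<partial>M)"
    by (simp add: power2_eq_square sum_product mult_ac)
  also have "\<dots> = (\<Sum>i\<in>{1..n}. \<Sum>j\<in>{1..n}. t i * t j * (\<integral>\<omega>. X i \<omega> * X j \<omega> \<partial>M))"
  proof -
    have int: "integrable M (\<lambda>\<omega>. t i * t j * (X i \<omega> * X j \<omega>))" if "i \<in> {1..n}" "j \<in> {1..n}" for i j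
      using integrable_X_product[OF that] by (rule integrable_mult_right)
    have "(\<integral>\<omega>. (\<Sum>i\<in>{1..n}. \<Sum>j\<in>{1..n}. t i * t j * (X i \<omega> * X j \<omega>)) \<partial>M)
        = (\<Sum>i\<in>{1..n}. \<integral>\<omega>. (\<Sum>j\<in>{1..n}. t i * t j * (X i \<omega> * X j \<omega>)) \<partial>M)"
      by (intro Bochner_Integration.integral_sum Bochner_Integration.integrable_sum int)
    also have "\<dots> = (\<Sum>i\<in>{1..n}. \<Sum>j\<in>{1..n}. \<integral>\<omega>. t i * t j * (X i \<omega> * X j \<omega>) \<partial>M)"
      by (intro sum.cong refl Bochner_Integration.integral_sum int)
    finally show ?thesis by simp
  qed
  also have "\<dots> = (\<Sum>i\<in>{1..n}. \<Sum>j\<in>{1..n}. t i * t j * (if i = j then 1 else \<rho>))"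
    by (intro sum.cong refl) (simp only: expectation_X_product)
  finally show ?thesis by (simp add: equicorrelation_quadratic_form)
qed

lemma FWER_measurable: "{\<omega> \<in> space M. \<exists>i\<in>{1..n}. X i \<omega> > c} \<in> sets M"
proof (rule sets.sets_Collect_finite_Ex)
  fix i assume "i \<in> {1..n}"
  then have [measurable]: "X i \<in> borel_measurable M" by (rule measurable_X)
  show "{\<omega> \<in> space M. X i \<omega> > c} \<in> sets M" by measurable
qed simp

text \<open>Uncorrelated jointly normal variables have a factorizing characteristic function, so
the probability of no rejection is a product.\<close>
lemma FWER_independent:
  assumes "\<rho> = 0"
  shows "FWER M n X c \<le> 1 - (1 - Phi (- c)) ^ n"
proof -
  have char: "(\<integral>\<omega>. iexp (\<Sum>i\<in>{1..n}. t i * X i \<omega>) \<partial>M) = of_real (exp (- (\<Sum>i\<in>{1..n}. (t i)\<^sup>2) / 2))" for t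
    by (rule char_centered_normal_rv[OF normal_rv_sum expectation_sum])
      (simp add: expectation_sum_square assms del: One_nat_def)
  have char1: "(\<integral>\<omega>. iexp (s * X i \<omega>) \<partial>M) = of_real (exp (- s\<^sup>2 / 2))" if "i \<in> {1..n}" for i s
  proof -
    have "(\<Sum>j\<in>{1..n}. (if j = i then s else 0) * X j \<omega>) = s * X i \<omega>" for \<omega>
      using that by (simp add: if_distrib[of "\<lambda>x. x * _"] cong: if_cong)
    moreover have "(\<Sum>j\<in>{1..n}. (if j = i then s else 0)\<^sup>2) = s\<^sup>2"
      using that by (simp add: if_distrib[of "\<lambda>x. x\<^sup>2"] cong: if_cong)
    ultimately show ?thesis using char[of "\<lambda>j. if j = i then s else 0"] by simp
  qed
  have "prob {\<omega> \<in> space M. \<forall>i\<in>{1..n}. X i \<omega> \<in> {..c}} = (\<Prod>i\<in>{1..n}. prob {\<omega> \<in> space M. X i \<omega> \<in> {..c}})"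
  proof (rule prob_product_if_joint_char_factors)
    fix t :: "nat \<Rightarrow> real"
    have "exp (- (\<Sum>i\<in>{1..n}. (t i)\<^sup>2) / 2) = (\<Prod>i\<in>{1..n}. exp (- (t i)\<^sup>2 / 2))"
      by (simp only: sum_negf[symmetric] sum_divide_distrib finite_atLeastAtMost flip: exp_sum)
    then show "(\<integral>\<omega>. iexp (\<Sum>i\<in>{1..n}. t i * X i \<omega>) \<partial>M) = (\<Prod>i\<in>{1..n}. \<integral>\<omega>. iexp (t i * X i \<omega>) \<partial>M)"
      by (simp only: char char1 of_real_prod cong: prod.cong)
  qed (auto intro: measurable_X)
  moreover have "(1 - Phi (- c)) ^ n \<le> (\<Prod>i\<in>{1..n}. prob {\<omega> \<in> space M. X i \<omega> \<in> {..c}})"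
  proof -
    have "1 - Phi (- c) \<le> prob {\<omega> \<in> space M. X i \<omega> \<in> {..c}}" if i: "i \<in> {1..n}" for i
    proof -
      have [measurable]: "X i \<in> borel_measurable M" using i by (rule measurable_X)
      have "prob {\<omega> \<in> space M. X i \<omega> \<in> {..c}} = 1 - prob {\<omega> \<in> space M. \<not> X i \<omega> \<le> c}"
        by (subst prob_neg) auto
      then show ?thesis using std_normal_tail_le[OF X_std_normal[OF i], of c] by (simp add: not_le)
    qed
    moreover have "0 \<le> 1 - Phi (- c)" 
      using std_normal.cdf_bounded_prob[of "-c"] by (simp add: Phi_def)
    ultimately have "(\<Prod>i\<in>{1..n}. 1 - Phi (- c)) \<le> (\<Prod>i\<in>{1..n}. prob {\<omega> \<in> space M. X i \<omega> \<in> {..c}})"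
      by (intro prod_mono) auto
    then show ?thesis by simp
  qed
  moreover have "prob {\<omega> \<in> space M. \<forall>i\<in>{1..n}. X i \<omega> \<in> {..c}} = 1 - FWER M n X c"
  proof -
    have "{\<omega> \<in> space M. \<forall>i\<in>{1..n}. X i \<omega> \<in> {..c}} = space M - {\<omega> \<in> space M. \<exists>i\<in>{1..n}. X i \<omega> > c}"
      by (auto simp: not_less simp del: One_nat_def)
    then show ?thesis unfolding FWER_def by (simp only: prob_compl[OF FWER_measurable])
  qed
  ultimately show ?thesis by simp
qed

text \<open>The differences have variance zero, so almost surely either all the observations exceed
\<open>c\<close> or none does.\<close>
lemma FWER_perfectly_correlated:
  assumes "\<rho> = 1" "n \<ge> 1"
  shows "FWER M n X c \<le> Phi (- c)"
proof -
  have n: "1 \<in> {1..n}" using assms by simp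
  have [measurable]: "X 1 \<in> borel_measurable M" using n by (rule measurable_X)
  have eq: "AE \<omega> in M. X i \<omega> = X 1 \<omega>" if i: "i \<in> {1..n}" for i
  proof -
    define t :: "nat \<Rightarrow> real" where "t j = (if j = i then 1 else 0) - (if j = 1 then 1 else 0)" for j
    have t: "(\<Sum>j\<in>{1..n}. t j * X j \<omega>) = X i \<omega> - X 1 \<omega>" for \<omega>
      using i n by (simp add: t_def left_diff_distrib sum_subtractf if_distrib[of "\<lambda>x. x * _"] cong: if_cong)
    have "(\<Sum>j\<in>{1..n}. t j) = 0" using i n by (simp add: t_def sum_subtractf)
    then have "(\<integral>\<omega>. (X i \<omega> - X 1 \<omega>)\<^sup>2 \<partial>M) = 0"
      using expectation_sum_square[of t] assms unfolding t by simp
    note moments = normal_rv_sum[of t, unfolded t] expectation_sum[of t, unfolded t] this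
    show ?thesis
    proof (rule centered_normal_rv_cases[OF moments])
      assume "AE \<omega> in M. X i \<omega> - X 1 \<omega> = 0"
      then show ?thesis by eventually_elim simp
    qed simp
  qed
  have "AE \<omega> in M. \<forall>i\<in>{1..n}. X i \<omega> = X 1 \<omega>"
    by (rule AE_finite_allI) (use eq in auto)
  then have "FWER M n X c \<le> prob {\<omega> \<in> space M. X 1 \<omega> > c}"
    unfolding FWER_def
  proof (intro finite_measure_mono_AE)
    show "{\<omega> \<in> space M. X 1 \<omega> > c} \<in> sets M" by measurable
  qed (auto elim!: eventually_mono simp del: One_nat_def)
  also have "\<dots> \<le> Phi (- c)" by (rule std_normal_tail_le[OF X_std_normal[OF n]])
  finally show ?thesis .
qed

text \<open>The average \<open>B\<close> of the observations stands in for the common factor. If some \<open>X i\<close>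
exceeds \<open>c\<close>, then either \<open>B\<close> exceeds \<open>\<delta> * c\<close> or the deviation \<open>X i - B\<close> exceeds
\<open>(1 - \<delta>) * c\<close>. Since \<open>B\<close> has variance at most \<open>1\<close> and each deviation has variance at
most \<open>1 - \<rho>\<close>, a union bound over the \<open>n + 1\<close> events gives the estimate.\<close>
lemma FWER_le_common_plus_idiosyncratic:
  assumes \<rho>: "0 \<le> \<rho>" "\<rho> < 1" and n: "n \<ge> 1" and c: "c \<ge> 0" and \<delta>: "0 \<le> \<delta>" "\<delta> \<le> 1"
  shows "FWER M n X c \<le> Phi (- \<delta> * c) + real n * Phi (- ((1 - \<delta>) / sqrt (1 - \<rho>) * c))"
proof -
  define B where "B \<omega> = (\<Sum>j\<in>{1..n}. (1 / real n) * X j \<omega>)" for \<omega>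
  have NB: "normal_rv M B" unfolding B_def by (rule normal_rv_sum)
  have [measurable]: "B \<in> borel_measurable M" using NB by (simp add: normal_rv_def)
  have tail_B: "prob {\<omega> \<in> space M. B \<omega> > \<delta> * c} \<le> Phi (- (\<delta> * c) / 1)"
  proof (rule centered_normal_tail_le[OF NB])
    show "(\<integral>\<omega>. B \<omega> \<partial>M) = 0" unfolding B_def by (rule expectation_sum)
    have "(\<integral>\<omega>. (B \<omega>)\<^sup>2 \<partial>M) = (1 - \<rho>) * (1 / real n) + \<rho>"
      using n unfolding B_def expectation_sum_square by (simp add: power2_eq_square)
    also have "\<dots> \<le> (1 - \<rho>) * 1 + \<rho>"
      using n \<rho> by (intro add_right_mono mult_left_mono) auto
    finally show "(\<integral>\<omega>. (B \<omega>)\<^sup>2 \<partial>M) \<le> 1\<^sup>2" by simp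
  qed (use c \<delta> in auto)
  have tail_X: "prob {\<omega> \<in> space M. X i \<omega> - B \<omega> > (1 - \<delta>) * c} \<le> Phi (- ((1 - \<delta>) * c) / sqrt (1 - \<rho>))"
    if i: "i \<in> {1..n}" for i
  proof -
    define t :: "nat \<Rightarrow> real" where "t j = (if j = i then 1 else 0) - 1 / real n" for j
    have t: "(\<Sum>j\<in>{1..n}. t j * X j \<omega>) = X i \<omega> - B \<omega>" for \<omega>
      using i unfolding t_def left_diff_distrib sum_subtractf B_def
      by (simp add: if_distrib[of "\<lambda>x. x * _"] cong: if_cong)
    have s1: "(\<Sum>j\<in>{1..n}. t j) = 0" using i n by (simp add: t_def sum_subtractf)
    have "(\<Sum>j\<in>{1..n}. (t j)\<^sup>2) = (\<Sum>j\<in>{1..n}. (if j = i then 1 - 2 / real n else 0) + (1 / real n)\<^sup>2)"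
      by (intro sum.cong) (auto simp: t_def power2_eq_square algebra_simps)
    also have "\<dots> = 1 - 1 / real n" using i n by (simp add: sum.distrib power2_eq_square)
    finally have s2: "(\<Sum>j\<in>{1..n}. (t j)\<^sup>2) \<le> 1" by simp
    have "(\<integral>\<omega>. (X i \<omega> - B \<omega>)\<^sup>2 \<partial>M) \<le> (sqrt (1 - \<rho>))\<^sup>2"
      using expectation_sum_square[of t] s1 s2 \<rho> unfolding t by (simp add: mult_left_le)
    moreover have "normal_rv M (\<lambda>\<omega>. X i \<omega> - B \<omega>)" "(\<integral>\<omega>. X i \<omega> - B \<omega> \<partial>M) = 0"
      using normal_rv_sum[of t] expectation_sum[of t] unfolding t .
    ultimately show ?thesis
      using \<rho> c \<delta> by (intro centered_normal_tail_le) auto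
  qed
  have Xm: "{\<omega> \<in> space M. X i \<omega> - B \<omega> > (1 - \<delta>) * c} \<in> sets M" if "i \<in> {1..n}" for i
  proof -
    have [measurable]: "X i \<in> borel_measurable M" using that by (rule measurable_X)
    show ?thesis by measurable
  qed
  have "{\<omega> \<in> space M. \<exists>i\<in>{1..n}. X i \<omega> > c} \<subseteq>
      {\<omega> \<in> space M. B \<omega> > \<delta> * c} \<union> (\<Union>i\<in>{1..n}. {\<omega> \<in> space M. X i \<omega> - B \<omega> > (1 - \<delta>) * c})"
  proof
    fix \<omega> assume "\<omega> \<in> {\<omega> \<in> space M. \<exists>i\<in>{1..n}. X i \<omega> > c}"
    then obtain i where "\<omega> \<in> space M" "i \<in> {1..n}" "X i \<omega> > c" by auto
    moreover from this have "B \<omega> > \<delta> * c \<or> X i \<omega> - B \<omega> > (1 - \<delta>) * c"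
      by (auto simp: algebra_simps)
    ultimately show "\<omega> \<in> {\<omega> \<in> space M. B \<omega> > \<delta> * c} \<union> (\<Union>i\<in>{1..n}. {\<omega> \<in> space M. X i \<omega> - B \<omega> > (1 - \<delta>) * c})"
      by blast
  qed
  then have "FWER M n X c \<le> prob ({\<omega> \<in> space M. B \<omega> > \<delta> * c} \<union> (\<Union>i\<in>{1..n}. {\<omega> \<in> space M. X i \<omega> - B \<omega> > (1 - \<delta>) * c}))"
    unfolding FWER_def by (rule finite_measure_mono) (use Xm in auto)
  also have "\<dots> \<le> prob {\<omega> \<in> space M. B \<omega> > \<delta> * c} + prob (\<Union>i\<in>{1..n}. {\<omega> \<in> space M. X i \<omega> - B \<omega> > (1 - \<delta>) * c})"
    by (rule measure_Un_le) (use Xm in auto)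
  also have "prob (\<Union>i\<in>{1..n}. {\<omega> \<in> space M. X i \<omega> - B \<omega> > (1 - \<delta>) * c})
      \<le> (\<Sum>i\<in>{1..n}. prob {\<omega> \<in> space M. X i \<omega> - B \<omega> > (1 - \<delta>) * c})"
    by (rule finite_measure_subadditive_finite) (use Xm in auto)
  also have "\<dots> \<le> (\<Sum>i\<in>{1..n}. Phi (- ((1 - \<delta>) * c) / sqrt (1 - \<rho>)))"
    by (rule sum_mono) (rule tail_X)
  finally show ?thesis using tail_B by simp
qed

end

section \<open>Asymptotics of the two bounds\<close>

lemma threshold_at_top:
  fixes \<alpha>s c :: "nat \<Rightarrow> real"
  assumes lim: "(\<lambda>n. real n * \<alpha>s n) \<longlonglongrightarrow> \<alpha>" and Phi: "\<And>n. n \<ge> 1 \<Longrightarrow> Phi (- c n) = \<alpha>s n"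
  shows "filterlim c at_top sequentially"
proof -
  have "(\<lambda>n. (real n * \<alpha>s n) * inverse (real n)) \<longlonglongrightarrow> \<alpha> * 0"
    by (intro tendsto_mult lim lim_inverse_n)
  moreover have "\<forall>\<^sub>F n in sequentially. (real n * \<alpha>s n) * inverse (real n) = \<alpha>s n"
    using eventually_gt_at_top[of 0] by eventually_elim simp
  ultimately have "\<alpha>s \<longlonglongrightarrow> 0" by (simp add: tendsto_cong)
  show ?thesis unfolding filterlim_at_top
  proof
    fix K
    have "\<forall>\<^sub>F n in sequentially. \<alpha>s n < Phi (- K)"
      using order_tendstoD(2)[OF \<open>\<alpha>s \<longlonglongrightarrow> 0\<close>] Phi_pos by blast
    then show "\<forall>\<^sub>F n in sequentially. K \<le> c n"
      using eventually_ge_at_top[of 1]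
    proof eventually_elim
      case (elim n)
      then have "\<not> - K \<le> - c n" using Phi_mono[of "-K" "- c n"] Phi[of n] by auto
      then show ?case by simp
    qed
  qed
qed

text \<open>The number of tests is of the order of \<open>1 / Phi (- c n)\<close>, and by \<open>Phi_scaled_le\<close> the tail
at \<open>\<kappa> * c n\<close> is of smaller order than \<open>Phi (- c n)\<close>.\<close>
lemma FWER_bound_tendsto_0:
  fixes \<alpha>s c :: "nat \<Rightarrow> real"
  assumes lim: "(\<lambda>n. real n * \<alpha>s n) \<longlonglongrightarrow> \<alpha>" and Phi: "\<And>n. n \<ge> 1 \<Longrightarrow> Phi (- c n) = \<alpha>s n"
    and \<delta>: "\<delta> > 0" and \<kappa>: "\<kappa> > 1"
  shows "(\<lambda>n. Phi (- \<delta> * c n) + real n * Phi (- (\<kappa> * c n))) \<longlonglongrightarrow> 0"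
proof -
  have c: "filterlim c at_top sequentially" by (rule threshold_at_top[OF lim Phi])
  have "filterlim (\<lambda>n. - \<delta> * c n) at_bot sequentially"
    by (rule filterlim_tendsto_neg_mult_at_bot[OF tendsto_const _ c]) (use \<delta> in simp)
  then have 1: "(\<lambda>n. Phi (- \<delta> * c n)) \<longlonglongrightarrow> 0"
    by (rule filterlim_compose[OF Phi_at_bot])
  have "((\<lambda>x. exp (- ((\<kappa>\<^sup>2 - 1) * x\<^sup>2 / 2))) \<longlongrightarrow> 0) at_top"
  proof -
    have k2: "(\<kappa>\<^sup>2 - 1) / 2 > 0" using \<kappa> by (simp add: one_less_power)
    have "filterlim (\<lambda>x::real. (\<kappa>\<^sup>2 - 1) / 2 * x\<^sup>2) at_top at_top"
      by (rule filterlim_tendsto_pos_mult_at_top[OF tendsto_const k2])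
        (rule filterlim_pow_at_top[OF _ filterlim_ident], simp)
    then have "filterlim (\<lambda>x::real. - ((\<kappa>\<^sup>2 - 1) / 2 * x\<^sup>2)) at_bot at_top"
      by (simp add: filterlim_uminus_at_top)
    from filterlim_compose[OF exp_at_bot this] show ?thesis by simp
  qed
  from filterlim_compose[OF this c]
  have "(\<lambda>n. exp (- ((\<kappa>\<^sup>2 - 1) * (c n)\<^sup>2 / 2))) \<longlonglongrightarrow> 0" .
  then have "(\<lambda>n. \<kappa> * exp (- ((\<kappa>\<^sup>2 - 1) * (c n)\<^sup>2 / 2)) * (real n * \<alpha>s n)) \<longlonglongrightarrow> \<kappa> * 0 * \<alpha>"
    by (intro tendsto_mult lim tendsto_const)
  then have ub: "(\<lambda>n. \<kappa> * exp (- ((\<kappa>\<^sup>2 - 1) * (c n)\<^sup>2 / 2)) * (real n * \<alpha>s n)) \<longlonglongrightarrow> 0" by simp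
  have "(\<lambda>n. real n * Phi (- (\<kappa> * c n))) \<longlonglongrightarrow> 0"
  proof (rule tendsto_sandwich[OF _ _ tendsto_const ub])
    show "\<forall>\<^sub>F n in sequentially. 0 \<le> real n * Phi (- (\<kappa> * c n))" by (simp add: Phi_nonneg)
    have "\<forall>\<^sub>F n in sequentially. 0 \<le> c n" using c by (simp add: filterlim_at_top)
    then show "\<forall>\<^sub>F n in sequentially. real n * Phi (- (\<kappa> * c n)) \<le> \<kappa> * exp (- ((\<kappa>\<^sup>2 - 1) * (c n)\<^sup>2 / 2)) * (real n * \<alpha>s n)"
      using eventually_ge_at_top[of 1]
    proof eventually_elim
      case (elim n)
      have "real n * Phi (- (\<kappa> * c n)) \<le> real n * (\<kappa> * exp (- ((\<kappa>\<^sup>2 - 1) * (c n)\<^sup>2 / 2)) * Phi (- c n))"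
        by (intro mult_left_mono Phi_scaled_le) (use \<kappa> elim in auto)
      then show ?case using Phi[of n] elim by (simp add: mult_ac)
    qed
  qed
  from tendsto_add[OF 1 this] show ?thesis by simp
qed

text \<open>The limit of the right-hand side is \<open>(1 - \<rho>) * (1 - exp (- \<alpha>))\<close>; the estimate
\<open>(1 - x) ^ n \<le> exp (- n * x)\<close> is enough to keep it away from zero.\<close>
lemma claimed_bound_eventually_ge:
  fixes \<alpha>s :: "nat \<Rightarrow> real"
  assumes \<alpha>s: "\<And>n. n \<ge> 1 \<Longrightarrow> 0 < \<alpha>s n \<and> \<alpha>s n < 1" and \<alpha>: "0 < \<alpha>"
    and lim: "(\<lambda>n. real n * \<alpha>s n) \<longlonglongrightarrow> \<alpha>" and \<rho>: "0 \<le> \<rho>" "\<rho> < 1"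
  shows "\<exists>\<epsilon>>0. \<forall>\<^sub>F n in sequentially. \<epsilon> \<le> \<alpha>s n + (1 - \<rho>) * (1 - \<alpha>s n - (1 - \<alpha>s n) ^ n)"
proof -
  define \<eta> where "\<eta> = 1 - exp (- \<alpha>)"
  have \<eta>: "\<eta> > 0" using \<alpha> by (simp add: \<eta>_def)
  have "(\<lambda>n. 1 - exp (- (real n * \<alpha>s n))) \<longlonglongrightarrow> \<eta>"
    unfolding \<eta>_def by (intro tendsto_intros lim)
  then have "\<forall>\<^sub>F n in sequentially. \<eta> / 2 < 1 - exp (- (real n * \<alpha>s n))"
    by (rule order_tendstoD(1)) (use \<eta> in simp)
  then have "\<forall>\<^sub>F n in sequentially. (1 - \<rho>) * (\<eta> / 2) \<le> \<alpha>s n + (1 - \<rho>) * (1 - \<alpha>s n - (1 - \<alpha>s n) ^ n)"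
    using eventually_ge_at_top[of 1]
  proof eventually_elim
    case (elim n)
    have a: "0 < \<alpha>s n" "\<alpha>s n < 1" using \<alpha>s[of n] elim by auto
    have "(1 - \<alpha>s n) ^ n \<le> exp (- \<alpha>s n) ^ n"
      using a exp_ge_add_one_self[of "- \<alpha>s n"] by (intro power_mono) auto
    also have "\<dots> = exp (- (real n * \<alpha>s n))" by (simp flip: exp_of_nat_mult)
    finally have "\<eta> / 2 \<le> 1 - (1 - \<alpha>s n) ^ n" using elim by simp
    then have "(1 - \<rho>) * (\<eta> / 2) \<le> (1 - \<rho>) * (1 - (1 - \<alpha>s n) ^ n)"
      using \<rho> by (intro mult_left_mono) auto
    also have "\<dots> \<le> \<rho> * \<alpha>s n + (1 - \<rho>) * (1 - (1 - \<alpha>s n) ^ n)" using a \<rho> by simp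
    also have "\<dots> = \<alpha>s n + (1 - \<rho>) * (1 - \<alpha>s n - (1 - \<alpha>s n) ^ n)" by (simp add: algebra_simps)
    finally show ?case .
  qed
  moreover have "(1 - \<rho>) * (\<eta> / 2) > 0" using \<eta> \<rho> by simp
  ultimately show ?thesis by blast
qed

section \<open>The family-wise error rate bound\<close>

theorem theorem5p1:
  fixes \<alpha>s c :: "nat \<Rightarrow> real" and \<alpha> :: real
  assumes "\<And>n. n \<ge> 1 \<Longrightarrow> 0 < \<alpha>s n \<and> \<alpha>s n < 1"
    and "0 < \<alpha>" and "\<alpha> < 1"
    and "(\<lambda>n. real n * \<alpha>s n) \<longlonglongrightarrow> \<alpha>"
    and "\<And>n. n \<ge> 1 \<Longrightarrow> Phi (- c n) = \<alpha>s n"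
  shows "\<forall>\<rho>\<in>{0..1}. \<exists>N\<ge>1. \<forall>n\<ge>N. \<forall>(M :: 'a measure) X.
           equicorrelated_std_normal M n \<rho> X \<longrightarrow>
           FWER M n X (c n) \<le> \<alpha>s n + (1 - \<rho>) * (1 - \<alpha>s n - (1 - \<alpha>s n) ^ n)"
proof
  fix \<rho> :: real assume \<rho>: "\<rho> \<in> {0..1}"
  have loc: "equicorrelated M n \<rho> X" if "equicorrelated_std_normal M n \<rho> X"
    for M :: "'a measure" and n X
    using that by (simp add: equicorrelated_def equicorrelated_axioms_def equicorrelated_std_normal_def)
  consider (indep) "\<rho> = 0" | (perfect) "\<rho> = 1" | (strict) "0 < \<rho>" "\<rho> < 1" using \<rho> by fastforce
  then show "\<exists>N\<ge>1. \<forall>n\<ge>N. \<forall>(M :: 'a measure) X. equicorrelated_std_normal M n \<rho> X \<longrightarrow>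
      FWER M n X (c n) \<le> \<alpha>s n + (1 - \<rho>) * (1 - \<alpha>s n - (1 - \<alpha>s n) ^ n)"
  proof cases
    case indep
    show ?thesis
    proof (intro exI[of _ 1] conjI allI impI)
      fix n :: nat and M :: "'a measure" and X
      assume "1 \<le> n" "equicorrelated_std_normal M n \<rho> X"
      then show "FWER M n X (c n) \<le> \<alpha>s n + (1 - \<rho>) * (1 - \<alpha>s n - (1 - \<alpha>s n) ^ n)"
        using equicorrelated.FWER_independent[OF loc indep, of M n X "c n"] assms(5)[of n] indep by simp
    qed simp
  next
    case perfect
    show ?thesis
    proof (intro exI[of _ 1] conjI allI impI)
      fix n :: nat and M :: "'a measure" and X
      assume "1 \<le> n" "equicorrelated_std_normal M n \<rho> X"
      then show "FWER M n X (c n) \<le> \<alpha>s n + (1 - \<rho>) * (1 - \<alpha>s n - (1 - \<alpha>s n) ^ n)"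
        using equicorrelated.FWER_perfectly_correlated[OF loc perfect, of M n X "c n"] assms(5)[of n] perfect by simp
    qed simp
  next
    case strict
    define \<sigma> where "\<sigma> = sqrt (1 - \<rho>)"
    have \<sigma>: "0 < \<sigma>" "\<sigma> < 1" using strict by (auto simp: \<sigma>_def)
    \<comment> \<open>Any positive \<open>\<delta> < 1 - \<sigma>\<close> would do: it makes \<open>(1 - \<delta>) / \<sigma>\<close> exceed \<open>1\<close>.\<close>
    define \<delta> where "\<delta> = (1 - \<sigma>) / 2"
    have \<delta>: "0 < \<delta>" "\<delta> < 1" and \<kappa>: "1 < (1 - \<delta>) / \<sigma>"
      using \<sigma> by (auto simp: \<delta>_def field_simps)
    define b where "b n = Phi (- \<delta> * c n) + real n * Phi (- ((1 - \<delta>) / \<sigma> * c n))" for n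
    have b: "b \<longlonglongrightarrow> 0"
      unfolding b_def by (rule FWER_bound_tendsto_0[OF assms(4,5) \<delta>(1) \<kappa>])
    obtain \<epsilon> where "\<epsilon> > 0" and \<epsilon>: "\<forall>\<^sub>F n in sequentially. \<epsilon> \<le> \<alpha>s n + (1 - \<rho>) * (1 - \<alpha>s n - (1 - \<alpha>s n) ^ n)"
      using claimed_bound_eventually_ge[OF assms(1,2,4) less_imp_le[OF strict(1)] strict(2)] by auto
    have "\<forall>\<^sub>F n in sequentially. b n < \<epsilon>" using order_tendstoD(2)[OF b \<open>\<epsilon> > 0\<close>] .
    moreover have "\<forall>\<^sub>F n in sequentially. 0 \<le> c n"
      using threshold_at_top[OF assms(4,5)] by (simp add: filterlim_at_top)
    ultimately have "\<forall>\<^sub>F n in sequentially. \<forall>(M :: 'a measure) X. equicorrelated_std_normal M n \<rho> X \<longrightarrow>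
      FWER M n X (c n) \<le> \<alpha>s n + (1 - \<rho>) * (1 - \<alpha>s n - (1 - \<alpha>s n) ^ n)"
      using \<epsilon> eventually_ge_at_top[of 1]
    proof eventually_elim
      case (elim n)
      have "FWER M n X (c n) \<le> b n" if "equicorrelated_std_normal M n \<rho> X" for M :: "'a measure" and X
        unfolding b_def \<sigma>_def
        by (rule equicorrelated.FWER_le_common_plus_idiosyncratic[OF loc[OF that]]) (use elim(2,4) strict \<delta> in simp_all)
      moreover have "b n \<le> \<alpha>s n + (1 - \<rho>) * (1 - \<alpha>s n - (1 - \<alpha>s n) ^ n)" using elim(1,3) by linarith
      ultimately show ?case by (blast intro: order_trans)
    qed
    then obtain N where "\<forall>n\<ge>N. \<forall>(M :: 'a measure) X. equicorrelated_std_normal M n \<rho> X \<longrightarrow>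
      FWER M n X (c n) \<le> \<alpha>s n + (1 - \<rho>) * (1 - \<alpha>s n - (1 - \<alpha>s n) ^ n)"
      unfolding eventually_sequentially by (rule exE)
    then show ?thesis by (intro exI[of _ "max N 1"]) auto
  qed
qed

end
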